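(* Consider the estimator's mechanism design problem (P) described in the context, when the effort cost functions satisfy $$-2\,\frac{\partial c_i(\xi_i)}{\partial \xi_i}-\frac{\partial^2 c_i(\xi_i)}{\partial \xi_i^2}\,(\xi_x+\xi_i)<0\qquad\text{for all }\xi_i\in[0,\xi_{iu}]\text{ and all } i .$$ Let $\tilde\xi=(\tilde\xi_1,\dots,\tilde\xi_N)$ be the optimal solution of $$\min_{\xi}\ \sum_{i=1}^N c_i(\xi_i)\quad\text{s.t.}\quad \sum_{i=1}^N\xi_i\ \ge\ \Sigma_t^{-1}-\xi_x,\qquad \xi_i\in[0,\xi_{iu}]\ \ (i=1,\dots,N).$$ Let the payment function to each sensor $i$ be $$p_i(\hat x_{ri},y_{rj})=\gamma_i-\beta_i(\hat x_{ri}-y_{rj})^2,$$ where $y_{rj}$ is the reported measurement from another agent $j\neq i$, with $$\beta_i=\left.\frac{\partial c_i(\xi_i)}{\partial \xi_i}\right|_{\xi_i=\tilde\xi_i}(\xi_x+\tilde\xi_i)^2,\qquad \gamma_i=\beta_i\left(\frac{1}{\xi_x+\tilde\xi_i}+\tilde\xi_j^{-1}\right)+c_i(\tilde\xi_i).$$ Then the strategy profile $s^*=(s_1^*,\dots,s_N^* )$ with $$s_i^*=(\xi_i=\tilde\xi_i,\ \hat x_{ri}=\hat x_i,\ y_{ri}=y_i)$$ is a Nash equilibrium of the mechanism design problem (P). In addition, the expected payment to each agent is its effort cost, i.e. $\mathbb{E}[p_i]=c_i(\tilde\xi_i)$.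
   Context: Estimation model. $X\sim\mathcal N(0,\sigma_x^2)$ is a scalar random variable taking an unknown value $x$; $\xi_x=\sigma_x^{-2}$. There are $N$ sensors (agents). Sensor $i$ observes $y_i=x+v_i$ with noise $v_i\sim\mathcal N(0,\sigma_i^2)$; the noises are mutually independent and independent of $X$. The quantity $\xi_i=\sigma_i^{-2}\in[0,\xi_{iu}]$ is the effort level of sensor $i$ and is chosen by the sensor ($\xi_i=0$ corresponds to $\sigma_i^2=\infty$). The local minimum mean square error (MMSE) estimate of sensor $i$ is $\hat x_i=\frac{\sigma_x^2}{\sigma_x^2+\sigma_i^2}\,y_i$, with local mean squared error (MSE) $\Sigma_i=\frac{1}{\xi_x+\xi_i}$. Effort costs. Effort level $\xi_i$ incurs the cost $c_i(\xi_i)$, where $c_i(\xi_i)\ge 0$, $\partial c_i(\xi_i)/\partial\xi_i>0$, $\xi_i\in[0,\xi_{iu}]$, $c_i(\xi_i)\in[0,c_{iu}]$, and $c_i(0)=0$; $c_i$ is twice differentiable. Strategies and utilities. A strategy of sensor $i$ is a tuple $s_i=(\xi_i,\hat x_{ri},y_{ri})$: its effort level, its reported local estimate and its reported measurement. The reports may be falsified, so they need not equal $\hat x_i$ and $y_i$; the sensor chooses them on the basis of its own information. $S_i$ is the set of feasible $s_i$, and $s_{-i}$ denotes the strategies of all sensors other than $i$. The measurements, local estimates and effort levels themselves are unknown to the estimator. The strategy $s_e\in S_e$ of the estimator consists of the payment functions $p_i(s_i,s_{-i})$ and a rule for fusing the reports into a global estimate, whose global MSE is $\Sigma_g$. The expected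 utility of sensor $i$ is $\mathbb E[U_i]=\mathbb E[p_i(s_i,s_{-i})-c_i(\xi_i)]$, with the expectation over $X$ and the measurement noises; each sensor maximizes it over $s_i\in S_i$. Mechanism design problem (P). With a specified threshold $\Sigma_t$ on the global MSE, the estimator solves $$\min_{s_e\in S_e}\ \mathbb E\Big[\sum_{i=1}^N p_i(s_i,s_{-i})\Big]\quad\text{s.t.}\quad \Sigma_g\le\Sigma_t,\quad \mathbb E[p_i(s_i,s_{-i})-c_i(\xi_i)]\ge 0\ \ \forall i,\quad s_i=\arg\max\mathbb E[p_i(s_i,s_{-i})-c_i(\xi_i)]\ \ \forall i .$$ This specifies a game among the sensors, whose behavior is described by a Nash equilibrium: a profile $s^*$ such that, for every $i$, $s_i^*$ maximizes $\mathbb E[U_i]$ over $s_i\in S_i$ when all the other sensors use $s_{-i}^*$.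
   Formalization: The formal statement assumes in addition that the agent j used in each sensor's payment has positive optimal effort (ξ̃_j > 0), since otherwise ξ̃_j^{-1}, and hence γ_i, is undefined. *)

theory Defs
  imports "HOL-Probability.Probability"
begin

text \<open>Sensors are the elements of a finite type \<open>'n\<close>. A sensor acts on what it has observed, so a
  report is a function of its own measurement.\<close>

record strategy =
  effort :: real
  est_report :: "real \<Rightarrow> real"
  meas_report :: "real \<Rightarrow> real"

definition feasible :: "real \<Rightarrow> strategy set" where
  "feasible \<xi>u = {s. effort s \<in> {0..\<xi>u} \<and> est_report s \<in> borel_measurable borel
                     \<and> meas_report s \<in> borel_measurable borel}"

text \<open>The noise of a sensor is a family of random variables indexed by its effort \<open>e\<close>, with variance
  \<open>1 / e\<close>. Effort \<open>0\<close> stands for infinite variance: the observation is then pure noise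
  carrying no information about \<open>X\<close> (the law of \<open>v 0\<close> is left arbitrary).\<close>

definition measurement :: "('w \<Rightarrow> real) \<Rightarrow> (real \<Rightarrow> 'w \<Rightarrow> real) \<Rightarrow> real \<Rightarrow> 'w \<Rightarrow> real" where
  "measurement X v e \<omega> = (if e = 0 then v 0 \<omega> else X \<omega> + v e \<omega>)"

text \<open>The case \<open>e = 0\<close> is the limit of infinite noise variance.\<close>

definition local_estimate :: "real \<Rightarrow> real \<Rightarrow> real \<Rightarrow> real" where
  "local_estimate \<sigma>x e y = (if e = 0 then 0 else \<sigma>x\<^sup>2 / (\<sigma>x\<^sup>2 + 1 / e) * y)"

definition truthful :: "real \<Rightarrow> real \<Rightarrow> strategy" where
  "truthful \<sigma>x e = \<lparr>effort = e, est_report = local_estimate \<sigma>x e, meas_report = (\<lambda>y. y)\<rparr>"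

definition reported_est ::
  "('w \<Rightarrow> real) \<Rightarrow> ('n \<Rightarrow> real \<Rightarrow> 'w \<Rightarrow> real) \<Rightarrow> ('n \<Rightarrow> strategy) \<Rightarrow> 'w \<Rightarrow> 'n \<Rightarrow> real" where
  "reported_est X v s \<omega> i = est_report (s i) (measurement X (v i) (effort (s i)) \<omega>)"

definition reported_meas ::
  "('w \<Rightarrow> real) \<Rightarrow> ('n \<Rightarrow> real \<Rightarrow> 'w \<Rightarrow> real) \<Rightarrow> ('n \<Rightarrow> strategy) \<Rightarrow> 'w \<Rightarrow> 'n \<Rightarrow> real" where
  "reported_meas X v s \<omega> i = meas_report (s i) (measurement X (v i) (effort (s i)) \<omega>)"

text \<open>Reports need not be square integrable, so expectations take values in the extended reals
  (the Bochner integral would assign \<open>0\<close> to an expected payment of \<open>-\<infinity>\<close>). Note that \<open>ennreal\<close>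
  sends negative reals to \<open>0\<close>.\<close>

definition expect :: "'w measure \<Rightarrow> ('w \<Rightarrow> real) \<Rightarrow> ereal" where
  "expect M f = enn2ereal (\<integral>\<^sup>+\<omega>. ennreal (f \<omega>) \<partial>M) - enn2ereal (\<integral>\<^sup>+\<omega>. ennreal (- f \<omega>) \<partial>M)"

text \<open>The estimator sees only the reports: \<open>p i xr yr\<close> is the payment to sensor \<open>i\<close> when the reported
  estimates are \<open>xr\<close> and the reported measurements are \<open>yr\<close>.\<close>

type_synonym 'n payment = "'n \<Rightarrow> ('n \<Rightarrow> real) \<Rightarrow> ('n \<Rightarrow> real) \<Rightarrow> real"

definition expected_payment ::
  "'w measure \<Rightarrow> ('w \<Rightarrow> real) \<Rightarrow> ('n \<Rightarrow> real \<Rightarrow> 'w \<Rightarrow> real) \<Rightarrow> 'n payment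
    \<Rightarrow> ('n \<Rightarrow> strategy) \<Rightarrow> 'n \<Rightarrow> ereal" where
  "expected_payment M X v p s i =
     expect M (\<lambda>\<omega>. p i (reported_est X v s \<omega>) (reported_meas X v s \<omega>))"

definition expected_utility ::
  "'w measure \<Rightarrow> ('w \<Rightarrow> real) \<Rightarrow> ('n \<Rightarrow> real \<Rightarrow> 'w \<Rightarrow> real) \<Rightarrow> ('n \<Rightarrow> real \<Rightarrow> real) \<Rightarrow> 'n payment
    \<Rightarrow> ('n \<Rightarrow> strategy) \<Rightarrow> 'n \<Rightarrow> ereal" where
  "expected_utility M X v c p s i =
     expect M (\<lambda>\<omega>. p i (reported_est X v s \<omega>) (reported_meas X v s \<omega>) - c i (effort (s i)))"

definition nash_equilibrium ::
  "'w measure \<Rightarrow> ('w \<Rightarrow> real) \<Rightarrow> ('n \<Rightarrow> real \<Rightarrow> 'w \<Rightarrow> real) \<Rightarrow> ('n \<Rightarrow> real \<Rightarrow> real) \<Rightarrow> ('n \<Rightarrow> real)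
    \<Rightarrow> 'n payment \<Rightarrow> ('n \<Rightarrow> strategy) \<Rightarrow> bool" where
  "nash_equilibrium M X v c \<xi>u p s \<longleftrightarrow>
     (\<forall>i. s i \<in> feasible (\<xi>u i)) \<and>
     (\<forall>i. \<forall>t \<in> feasible (\<xi>u i).
        expected_utility M X v c p (s(i := t)) i \<le> expected_utility M X v c p s i)"

definition fusion_rules :: "(('n \<Rightarrow> real) \<Rightarrow> ('n \<Rightarrow> real) \<Rightarrow> real) set" where
  "fusion_rules = {g. (\<lambda>(xr, yr). g xr yr) \<in>
     borel_measurable (Pi\<^sub>M UNIV (\<lambda>_. borel) \<Otimes>\<^sub>M Pi\<^sub>M UNIV (\<lambda>_. borel))}"

definition global_mse ::
  "'w measure \<Rightarrow> ('w \<Rightarrow> real) \<Rightarrow> ('n \<Rightarrow> real \<Rightarrow> 'w \<Rightarrow> real)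
    \<Rightarrow> (('n \<Rightarrow> real) \<Rightarrow> ('n \<Rightarrow> real) \<Rightarrow> real) \<Rightarrow> ('n \<Rightarrow> strategy) \<Rightarrow> ereal" where
  "global_mse M X v g s =
     expect M (\<lambda>\<omega>. (g (reported_est X v s \<omega>) (reported_meas X v s \<omega>) - X \<omega>)\<^sup>2)"

text \<open>The three constraints of the estimator's problem, for payments \<open>p\<close> and fusion rule \<open>g\<close>:
  accuracy, individual rationality and incentive compatibility.\<close>

definition P_feasible ::
  "'w measure \<Rightarrow> ('w \<Rightarrow> real) \<Rightarrow> ('n \<Rightarrow> real \<Rightarrow> 'w \<Rightarrow> real) \<Rightarrow> ('n \<Rightarrow> real \<Rightarrow> real) \<Rightarrow> ('n \<Rightarrow> real)
    \<Rightarrow> real \<Rightarrow> 'n payment \<Rightarrow> (('n \<Rightarrow> real) \<Rightarrow> ('n \<Rightarrow> real) \<Rightarrow> real) \<Rightarrow> ('n \<Rightarrow> strategy) \<Rightarrow> bool" where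
  "P_feasible M X v c \<xi>u \<Sigma>t p g s \<longleftrightarrow>
     global_mse M X v g s \<le> ereal \<Sigma>t \<and>
     (\<forall>i. 0 \<le> expected_utility M X v c p s i) \<and>
     nash_equilibrium M X v c \<xi>u p s"

end

theory Submission
  imports Defs
begin

text \<open>The mean squared deviation of any report \<open>f y\<^sub>i\<close> from \<open>y\<^sub>j = X + v\<^sub>j\<close> splits, by independence of
  \<open>v\<^sub>j\<close> and by Gaussian conditioning, into the noise variance \<open>1 / \<xi>\<^sub>j\<close>, the posterior variance
  \<open>1 / (\<xi>x + \<xi>\<^sub>i)\<close> and the mean squared distance of \<open>f y\<^sub>i\<close> from the MMSE estimate. So truthful
  reporting is optimal at every effort level, and the sensor is left with minimizing
  \<open>c\<^sub>i \<xi> + \<beta>\<^sub>i / (\<xi>x + \<xi>)\<close>. Its derivative has the sign of \<open>c\<^sub>i' \<xi> * (\<xi>x + \<xi>)\<^sup>2 - \<beta>\<^sub>i\<close>, which is increasing by the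
  assumption on the costs and vanishes at the prescribed effort by the choice of \<open>\<beta>\<^sub>i\<close>. Accuracy is
  met by the effort-weighted mean of the measurements, with error \<open>1 / (\<xi>x + \<Sum>\<xi>\<^sub>i)\<close>.\<close>

section \<open>Gaussian second moments and the posterior density\<close>

text \<open>Expanding the square about \<open>\<mu>\<close> leaves the variance, a first central
  moment that vanishes, and the squared bias. The \<open>ennreal\<close> form lets \<open>z\<close>
  later be a report with infinite second moment.\<close>

lemma nn_integral_normal_square:
  assumes \<sigma>: "\<sigma> > 0"
  shows "(\<integral>\<^sup>+x. ennreal (normal_density \<mu> \<sigma> x) * ennreal ((z - x)\<^sup>2) \<partial>lborel)
    = ennreal (\<sigma>\<^sup>2) + ennreal ((z - \<mu>)\<^sup>2)"
proof -
  have "has_bochner_integral lborel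
      (\<lambda>x. normal_density \<mu> \<sigma> x * (x - \<mu>)\<^sup>2
        + (- 2 * (z - \<mu>)) * (normal_density \<mu> \<sigma> x * (x - \<mu>))
        + (z - \<mu>)\<^sup>2 * normal_density \<mu> \<sigma> x)
      (\<sigma>\<^sup>2 + (- 2 * (z - \<mu>)) * 0 + (z - \<mu>)\<^sup>2 * 1)"
    using normal_moment_even[OF \<sigma>, of \<mu> 1] normal_moment_odd[OF \<sigma>, of \<mu> 0]
      normal_moment_even[OF \<sigma>, of \<mu> 0]
    by (intro has_bochner_integral_add has_bochner_integral_mult_right) simp_all
  also have "(\<lambda>x. normal_density \<mu> \<sigma> x * (x - \<mu>)\<^sup>2
        + (- 2 * (z - \<mu>)) * (normal_density \<mu> \<sigma> x * (x - \<mu>))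
        + (z - \<mu>)\<^sup>2 * normal_density \<mu> \<sigma> x) = (\<lambda>x. normal_density \<mu> \<sigma> x * (z - x)\<^sup>2)"
    by (rule ext) (simp add: algebra_simps power2_eq_square)
  finally have "(\<integral>\<^sup>+x. ennreal (normal_density \<mu> \<sigma> x * (z - x)\<^sup>2) \<partial>lborel)
      = ennreal (\<sigma>\<^sup>2 + (z - \<mu>)\<^sup>2)"
    by (subst nn_integral_eq_integral)
      (auto simp: has_bochner_integral_iff normal_density_nonneg)
  then show ?thesis
    by (simp add: ennreal_mult normal_density_nonneg)
qed

text \<open>Bayes' rule for a Gaussian prior of variance \<open>a\<close> and Gaussian noise of variance \<open>b\<close>: law of
  the observation times posterior density.\<close>

lemma normal_density_posterior:
  assumes [arith]: "a > 0" "b > 0"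
  shows "normal_density 0 (sqrt a) x * normal_density 0 (sqrt b) (y - x)
    = normal_density 0 (sqrt (a + b)) y
      * normal_density (a / (a + b) * y) (sqrt (a * b / (a + b))) x"
proof -
  have [simp]: "a + b \<noteq> 0" "a \<noteq> 0" "b \<noteq> 0" by linarith+
  \<comment> \<open>Completing the square in \<open>x\<close>. The normalising constants match
    because the two variances on the right multiply to \<open>a * b\<close>.\<close>
  have "- x\<^sup>2 / (2 * a) + - (y - x)\<^sup>2 / (2 * b)
    = - y\<^sup>2 / (2 * (a + b)) + - (x - a / (a + b) * y)\<^sup>2 / (2 * (a * b / (a + b)))"
    by (simp add: divide_simps power2_eq_square) algebra
  moreover have "sqrt (2 * pi * a) * sqrt (2 * pi * b)
      = sqrt (2 * pi * (a + b)) * sqrt (2 * pi * (a * b / (a + b)))"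
    by (simp add: real_sqrt_mult[symmetric] del: real_sqrt_eq_iff) (simp add: field_simps)
  ultimately show ?thesis
    by (simp add: normal_density_def exp_add[symmetric] real_sqrt_mult del: real_sqrt_eq_iff)
qed

section \<open>Mean squared errors under independence\<close>

context prob_space
begin

text \<open>Independence turns the joint law into a product, so \<open>V\<close> can be integrated
  out with \<open>Z\<close> frozen. In the uses below \<open>V\<close> is either the noise of the
  peer sensor or, at zero effort, \<open>X\<close> itself.\<close>

lemma nn_integral_indep_normal_square:
  assumes ind: "indep_var borel V borel Z"
    and V: "distributed M lborel V (normal_density \<mu> \<sigma>)" and \<sigma>: "\<sigma> > 0"
  shows "(\<integral>\<^sup>+\<omega>. ennreal ((Z \<omega> - V \<omega>)\<^sup>2) \<partial>M)
    = ennreal (\<sigma>\<^sup>2) + (\<integral>\<^sup>+\<omega>. ennreal ((Z \<omega> - \<mu>)\<^sup>2) \<partial>M)"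
proof -
  have [measurable]: "V \<in> borel_measurable M" "Z \<in> borel_measurable M"
    using indep_var_rv1[OF ind] indep_var_rv2[OF ind] by auto
  interpret V: prob_space "distr M borel V" by (rule prob_space_distr) simp
  interpret Z: prob_space "distr M borel Z" by (rule prob_space_distr) simp
  interpret pair: pair_sigma_finite "distr M borel V" "distr M borel Z" ..
  have inner: "(\<integral>\<^sup>+v. ennreal ((z - v)\<^sup>2) \<partial>distr M borel V)
      = ennreal (\<sigma>\<^sup>2) + ennreal ((z - \<mu>)\<^sup>2)" for z
    using nn_integral_normal_square[OF \<sigma>, of \<mu> z]
      distributed_nn_integral[OF V, of "\<lambda>v. ennreal ((z - v)\<^sup>2)"]
    by (simp add: nn_integral_distr)
  have "(\<integral>\<^sup>+\<omega>. ennreal ((Z \<omega> - V \<omega>)\<^sup>2) \<partial>M)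
      = (\<integral>\<^sup>+q. ennreal ((snd q - fst q)\<^sup>2) \<partial>distr M (borel \<Otimes>\<^sub>M borel) (\<lambda>\<omega>. (V \<omega>, Z \<omega>)))"
    by (subst nn_integral_distr) auto
  also have "distr M (borel \<Otimes>\<^sub>M borel) (\<lambda>\<omega>. (V \<omega>, Z \<omega>)) = distr M borel V \<Otimes>\<^sub>M distr M borel Z"
    using ind by (simp add: indep_var_distribution_eq)
  also have "(\<integral>\<^sup>+q. ennreal ((snd q - fst q)\<^sup>2) \<partial>(distr M borel V \<Otimes>\<^sub>M distr M borel Z))
      = (\<integral>\<^sup>+z. \<integral>\<^sup>+v. ennreal ((z - v)\<^sup>2) \<partial>distr M borel V \<partial>distr M borel Z)"
    by (subst pair.nn_integral_snd[symmetric]) auto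
  also have "\<dots> = (\<integral>\<^sup>+\<omega>. (ennreal (\<sigma>\<^sup>2) + ennreal ((Z \<omega> - \<mu>)\<^sup>2)) \<partial>M)"
    unfolding inner by (subst nn_integral_distr) auto
  also have "\<dots> = ennreal (\<sigma>\<^sup>2) + (\<integral>\<^sup>+\<omega>. ennreal ((Z \<omega> - \<mu>)\<^sup>2) \<partial>M)"
    by (subst nn_integral_add) (auto simp: emeasure_space_1)
  finally show ?thesis .
qed

text \<open>Conditioning on the observation is done at the level of densities: once the joint
  density is written as the law of \<open>y\<close> times the posterior of \<open>x\<close>, the
  inner integral over \<open>x\<close> is a Gaussian second moment about \<open>f y\<close>. Both
  sides may be infinite.\<close>

lemma mse_decomposition:
  fixes f :: "real \<Rightarrow> real"
  assumes ind: "indep_var borel X borel U"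
    and X: "distributed M lborel X (normal_density 0 (sqrt a))"
    and U: "distributed M lborel U (normal_density 0 (sqrt b))"
    and ab[arith]: "a > 0" "b > 0" and f[measurable]: "f \<in> borel_measurable borel"
  shows "(\<integral>\<^sup>+\<omega>. ennreal ((f (X \<omega> + U \<omega>) - X \<omega>)\<^sup>2) \<partial>M) = ennreal (a * b / (a + b))
    + (\<integral>\<^sup>+\<omega>. ennreal ((f (X \<omega> + U \<omega>) - a / (a + b) * (X \<omega> + U \<omega>))\<^sup>2) \<partial>M)"
proof -
  have [measurable]: "X \<in> borel_measurable M" "U \<in> borel_measurable M"
    using indep_var_rv1[OF ind] indep_var_rv2[OF ind] by auto
  have Y: "distributed M lborel (\<lambda>\<omega>. X \<omega> + U \<omega>) (normal_density 0 (sqrt (a + b)))"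
    using add_indep_normal[OF ind _ _ X U] by simp
  have indL: "indep_var lborel X lborel U"
    using indep_var_compose[OF ind, of "\<lambda>x. x" lborel "\<lambda>x. x" lborel] by (simp add: comp_def)
  let ?n = "normal_density 0 (sqrt (a + b))"
  let ?q = "\<lambda>y. normal_density (a / (a + b) * y) (sqrt (a * b / (a + b)))"
  have tau: "sqrt (a * b / (a + b)) > 0" by simp
  have "(\<integral>\<^sup>+\<omega>. ennreal ((f (X \<omega> + U \<omega>) - X \<omega>)\<^sup>2) \<partial>M)
      = (\<integral>\<^sup>+(x, u). (ennreal (normal_density 0 (sqrt a) x) * ennreal (normal_density 0 (sqrt b) u))
          * ennreal ((f (x + u) - x)\<^sup>2) \<partial>(lborel \<Otimes>\<^sub>M lborel))"
    using distributed_nn_integral[OF distributed_joint_indep[OF lborel.sigma_finite_measure_axioms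
        lborel.sigma_finite_measure_axioms X U indL], of "\<lambda>(x, u). ennreal ((f (x + u) - x)\<^sup>2)"]
    by (simp add: split_beta')
  also have "\<dots> = (\<integral>\<^sup>+x. \<integral>\<^sup>+u. (ennreal (normal_density 0 (sqrt a) x) * ennreal (normal_density 0 (sqrt b) u))
          * ennreal ((f (x + u) - x)\<^sup>2) \<partial>lborel \<partial>lborel)"
    by (subst lborel.nn_integral_fst[symmetric]) auto
  \<comment> \<open>Substituting \<open>u = y - x\<close> makes the observation an integration
    variable, as Bayes' rule requires.\<close>
  also have "\<dots> = (\<integral>\<^sup>+x. \<integral>\<^sup>+y. (ennreal (normal_density 0 (sqrt a) x) * ennreal (normal_density 0 (sqrt b) (y - x)))
          * ennreal ((f y - x)\<^sup>2) \<partial>lborel \<partial>lborel)"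
  proof (rule nn_integral_cong)
    fix x :: real
    show "(\<integral>\<^sup>+u. (ennreal (normal_density 0 (sqrt a) x) * ennreal (normal_density 0 (sqrt b) u))
          * ennreal ((f (x + u) - x)\<^sup>2) \<partial>lborel)
        = (\<integral>\<^sup>+y. (ennreal (normal_density 0 (sqrt a) x) * ennreal (normal_density 0 (sqrt b) (y - x)))
          * ennreal ((f y - x)\<^sup>2) \<partial>lborel)"
      by (subst (2) nn_integral_real_affine[where c = 1 and t = x]) auto
  qed
  also have "\<dots> = (\<integral>\<^sup>+x. \<integral>\<^sup>+y. ennreal (?n y) * (ennreal (?q y x) * ennreal ((f y - x)\<^sup>2)) \<partial>lborel \<partial>lborel)"
    by (simp add: ennreal_mult[symmetric] normal_density_nonneg normal_density_posterior
        mult.assoc[symmetric])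
  also have "\<dots> = (\<integral>\<^sup>+y. \<integral>\<^sup>+x. ennreal (?n y) * (ennreal (?q y x) * ennreal ((f y - x)\<^sup>2)) \<partial>lborel \<partial>lborel)"
    \<comment> \<open>The posterior mean depends on \<open>y\<close>; unfolding the density exposes
      joint measurability in both variables.\<close>
    unfolding normal_density_def by (rule lborel_pair.Fubini') measurable
  also have "\<dots> = (\<integral>\<^sup>+y. ennreal (?n y) * (ennreal (a * b / (a + b))
      + ennreal ((f y - a / (a + b) * y)\<^sup>2)) \<partial>lborel)"
    by (simp add: nn_integral_cmult nn_integral_normal_square[OF tau])
  also have "\<dots> = (\<integral>\<^sup>+\<omega>. (ennreal (a * b / (a + b))
      + ennreal ((f (X \<omega> + U \<omega>) - a / (a + b) * (X \<omega> + U \<omega>))\<^sup>2)) \<partial>M)"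
    by (subst distributed_nn_integral[OF Y]) auto
  also have "\<dots> = ennreal (a * b / (a + b))
    + (\<integral>\<^sup>+\<omega>. ennreal ((f (X \<omega> + U \<omega>) - a / (a + b) * (X \<omega> + U \<omega>))\<^sup>2) \<partial>M)"
    by (subst nn_integral_add) (auto simp: emeasure_space_1)
  finally show ?thesis .
qed

section \<open>Payments with a possibly infinite expected penalty\<close>

text \<open>The integrand is bounded above by \<open>k\<close>, so its positive part has a finite
  integral and \<open>expect\<close> never subtracts infinity from infinity. Reports that are not
  square integrable thus receive expected payment minus infinity.\<close>

lemma expect_affine:
  assumes g[measurable]: "g \<in> borel_measurable M" and g0: "\<And>\<omega>. g \<omega> \<ge> 0" and b: "b > 0"
  shows "expect M (\<lambda>\<omega>. k - b * g \<omega>) = ereal k - ereal b * enn2ereal (\<integral>\<^sup>+\<omega>. ennreal (g \<omega>) \<partial>M)"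
proof (cases "(\<integral>\<^sup>+\<omega>. ennreal (g \<omega>) \<partial>M) = \<infinity>")
  case True
  have "(\<integral>\<^sup>+\<omega>. ennreal (k - b * g \<omega>) \<partial>M) \<le> (\<integral>\<^sup>+\<omega>. ennreal \<bar>k\<bar> \<partial>M)"
    using g0 b by (intro nn_integral_mono ennreal_leI) (smt (verit) mult_nonneg_nonneg)
  then have pos: "(\<integral>\<^sup>+\<omega>. ennreal (k - b * g \<omega>) \<partial>M) \<noteq> \<infinity>"
    by (auto simp: emeasure_space_1 top_unique)
  have "\<infinity> = ennreal b * (\<integral>\<^sup>+\<omega>. ennreal (g \<omega>) \<partial>M)"
    using True b by (simp add: ennreal_mult_top)
  also have "\<dots> = (\<integral>\<^sup>+\<omega>. ennreal (b * g \<omega>) \<partial>M)"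
    using g0 b by (simp add: nn_integral_cmult ennreal_mult)
  \<comment> \<open>Pointwise, \<open>b * g\<close> exceeds the negative part of
    \<open>k - b * g\<close> by at most \<open>\<bar>k\<bar>\<close>, so an infinite integral of
    \<open>g\<close> forces an infinite negative part.\<close>
  also have "\<dots> \<le> (\<integral>\<^sup>+\<omega>. (ennreal (- (k - b * g \<omega>)) + ennreal \<bar>k\<bar>) \<partial>M)"
  proof (rule nn_integral_mono)
    fix \<omega>
    show "ennreal (b * g \<omega>) \<le> ennreal (- (k - b * g \<omega>)) + ennreal \<bar>k\<bar>"
      by (cases "b * g \<omega> \<ge> k")
        (auto simp: ennreal_neg ennreal_plus[symmetric] simp del: ennreal_plus intro!: ennreal_leI)
  qed
  also have "\<dots> = (\<integral>\<^sup>+\<omega>. ennreal (- (k - b * g \<omega>)) \<partial>M) + ennreal \<bar>k\<bar>"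
    by (subst nn_integral_add) (auto simp: emeasure_space_1)
  finally have neg: "(\<integral>\<^sup>+\<omega>. ennreal (- (k - b * g \<omega>)) \<partial>M) = \<infinity>"
    by (simp add: top_unique)
  show ?thesis
    using pos neg True b unfolding expect_def
    by (cases "\<integral>\<^sup>+\<omega>. ennreal (k - b * g \<omega>) \<partial>M") (auto simp: top_ennreal.rep_eq infinity_ennreal_def)
next
  case False
  then have int: "integrable M g"
    by (intro integrableI_nonneg) (auto simp: g0 top.not_eq_extremum)
  then have int': "integrable M (\<lambda>\<omega>. k - b * g \<omega>)" by simp
  have fin: "(\<integral>\<^sup>+\<omega>. ennreal (k - b * g \<omega>) \<partial>M) \<noteq> \<infinity>" "(\<integral>\<^sup>+\<omega>. ennreal (- (k - b * g \<omega>)) \<partial>M) \<noteq> \<infinity>"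
    using int' by (auto simp: real_integrable_def)
  have "expect M (\<lambda>\<omega>. k - b * g \<omega>) = ereal (\<integral>\<omega>. (k - b * g \<omega>) \<partial>M)"
    unfolding real_lebesgue_integral_def[OF int'] expect_def using fin
    by (cases "\<integral>\<^sup>+\<omega>. ennreal (k - b * g \<omega>) \<partial>M"; cases "\<integral>\<^sup>+\<omega>. ennreal (- (k - b * g \<omega>)) \<partial>M")
      (auto simp: enn2ereal_ennreal)
  also have "(\<integral>\<omega>. (k - b * g \<omega>) \<partial>M) = k - b * (\<integral>\<omega>. g \<omega> \<partial>M)"
    using int by (simp add: prob_space)
  finally show ?thesis
    using int g0 by (simp add: nn_integral_eq_integral enn2ereal_ennreal integral_nonneg_AE)
qed

section \<open>Errors of a report, including zero effort\<close>

lemma measurement_mse_decomposition: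
  fixes f :: "real \<Rightarrow> real"
  assumes ind: "indep_var borel X borel (u e)"
    and X: "distributed M lborel X (normal_density 0 \<sigma>)" and \<sigma>[arith]: "\<sigma> > 0"
    and U: "e > 0 \<Longrightarrow> distributed M lborel (u e) (normal_density 0 (sqrt (1 / e)))"
    and e: "e \<ge> 0" and f[measurable]: "f \<in> borel_measurable borel"
  shows "(\<integral>\<^sup>+\<omega>. ennreal ((f (measurement X u e \<omega>) - X \<omega>)\<^sup>2) \<partial>M) = ennreal (1 / (1 / \<sigma>\<^sup>2 + e))
    + (\<integral>\<^sup>+\<omega>. ennreal ((f (measurement X u e \<omega>) - local_estimate \<sigma> e (measurement X u e \<omega>))\<^sup>2) \<partial>M)"
proof (cases "e = 0")
  case True
  \<comment> \<open>At zero effort the report is independent of \<open>X\<close>, so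
    \<open>X\<close> plays the role of the independent Gaussian: the error is the prior variance
    plus the squared distance to the prior mean \<open>0\<close>, which is the local
    estimate.\<close>
  have "indep_var borel X borel (f \<circ> u e)"
    using indep_var_compose[OF ind, of "\<lambda>x. x" borel f borel] by (simp add: comp_def)
  from nn_integral_indep_normal_square[OF this X \<sigma>] True show ?thesis
    by (simp add: measurement_def local_estimate_def)
next
  case False
  with e have e[arith]: "e > 0" by simp
  \<comment> \<open>The posterior variance for noise variance \<open>1 / e\<close>, rewritten as the
    inverse of the summed precisions.\<close>
  have "\<sigma>\<^sup>2 * (1 / e) / (\<sigma>\<^sup>2 + 1 / e) = 1 / (1 / \<sigma>\<^sup>2 + e)"
    by (simp add: field_simps)
  with mse_decomposition[OF ind, of "\<sigma>\<^sup>2" "1 / e" f] X U[OF e] False show ?thesis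
    by (simp add: measurement_def local_estimate_def)
qed

lemma indep_var_of_indep_vars:
  assumes ind: "indep_vars (\<lambda>_. borel) W UNIV" and AB: "A \<inter> B = {}"
    and F: "F \<in> borel_measurable (PiM A (\<lambda>_. borel))" and G: "G \<in> borel_measurable (PiM B (\<lambda>_. borel))"
  shows "indep_var borel (\<lambda>\<omega>. F (\<lambda>k\<in>A. W k \<omega>)) borel (\<lambda>\<omega>. G (\<lambda>k\<in>B. W k \<omega>))"
  using indep_var_compose[OF indep_var_restrict[OF ind AB] F G] by (simp add: comp_def)

text \<open>Here \<open>X + V j\<close> is the truthful measurement of the peer at effort
  \<open>d\<close>. Its noise is independent of the pair formed by \<open>X\<close> and
  \<open>V i\<close>, hence of the error of the report about \<open>X\<close>; so it only adds its
  variance, and the remaining error splits as before.\<close>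

lemma report_error:
  fixes f :: "real \<Rightarrow> real" and V :: "'n \<Rightarrow> 'a \<Rightarrow> real"
  assumes ind: "indep_vars (\<lambda>_. borel) (case_option X V) UNIV"
    and X: "distributed M lborel X (normal_density 0 \<sigma>)" and \<sigma>: "\<sigma> > 0"
    and U: "e > 0 \<Longrightarrow> distributed M lborel (u e) (normal_density 0 (sqrt (1 / e)))"
    and e: "e \<ge> 0" and f[measurable]: "f \<in> borel_measurable borel"
    and Vi: "V i = u e" and ij: "j \<noteq> i"
    and Vj: "distributed M lborel (V j) (normal_density 0 (sqrt (1 / d)))" and d: "d > 0"
  shows "(\<integral>\<^sup>+\<omega>. ennreal ((f (measurement X u e \<omega>) - (X \<omega> + V j \<omega>))\<^sup>2) \<partial>M)
    = ennreal (1 / (1 / \<sigma>\<^sup>2 + e) + inverse d)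
    + (\<integral>\<^sup>+\<omega>. ennreal ((f (measurement X u e \<omega>) - local_estimate \<sigma> e (measurement X u e \<omega>))\<^sup>2) \<partial>M)"
proof -
  have indX: "indep_var borel X borel (u e)"
    using indep_var_of_indep_vars[OF ind, of "{None}" "{Some i}" "\<lambda>r. r None" "\<lambda>r. r (Some i)"]
    by (simp add: Vi)
  have Y: "measurement X u e = (\<lambda>\<omega>. if e = 0 then V i \<omega> else X \<omega> + V i \<omega>)"
    by (auto simp: Vi measurement_def)
  have "indep_var borel (V j) borel (\<lambda>\<omega>. f (measurement X u e \<omega>) - X \<omega>)"
    using indep_var_of_indep_vars[OF ind, of "{Some j}" "{None, Some i}" "\<lambda>r. r (Some j)"
        "\<lambda>r. f (if e = 0 then r (Some i) else r None + r (Some i)) - r None"] ij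
    unfolding Y by (cases "e = 0") simp_all
  from nn_integral_indep_normal_square[OF this Vj]
    measurement_mse_decomposition[of X u e, OF indX X \<sigma> U e f] d
  have "(\<integral>\<^sup>+\<omega>. ennreal ((f (measurement X u e \<omega>) - X \<omega> - V j \<omega>)\<^sup>2) \<partial>M)
    = ennreal (inverse d) + (ennreal (1 / (1 / \<sigma>\<^sup>2 + e))
    + (\<integral>\<^sup>+\<omega>. ennreal ((f (measurement X u e \<omega>) - local_estimate \<sigma> e (measurement X u e \<omega>))\<^sup>2) \<partial>M))"
    by (simp add: inverse_eq_divide)
  then show ?thesis
    using d e \<sigma> by (simp add: diff_diff_eq ac_simps)
qed

section \<open>Accuracy of the fused estimate\<close>

text \<open>With precision weights, the fusion error is a linear combination of \<open>X\<close> and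
  the noises, which are independent centred Gaussians; only its variance has to be computed.\<close>

lemma fusion_error:
  fixes v :: "'n::finite \<Rightarrow> real \<Rightarrow> 'a \<Rightarrow> real"
  assumes ind: "indep_vars (\<lambda>_. borel) (case_option X (\<lambda>i. v i (\<xi> i))) UNIV"
    and X: "distributed M lborel X (normal_density 0 \<sigma>)" and \<sigma>: "\<sigma> > 0"
    and v: "\<And>i. \<xi> i > 0 \<Longrightarrow> distributed M lborel (v i (\<xi> i)) (normal_density 0 (sqrt (1 / \<xi> i)))"
    and \<xi>: "\<And>i. \<xi> i \<ge> 0"
  defines "S \<equiv> 1 / \<sigma>\<^sup>2 + (\<Sum>i\<in>UNIV. \<xi> i)"
  shows "(\<integral>\<^sup>+\<omega>. ennreal (((\<Sum>i\<in>UNIV. \<xi> i * measurement X (v i) (\<xi> i) \<omega>) / S - X \<omega>)\<^sup>2) \<partial>M)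
    = ennreal (1 / S)"
proof -
  have S: "S > 0"
    unfolding S_def using \<sigma> \<xi> by (intro add_pos_nonneg sum_nonneg) auto
  \<comment> \<open>Sensors with zero effort have weight zero and noise of unspecified law, so the
    Gaussian sum runs over \<open>X\<close> and the active sensors only.\<close>
  define P where "P = {i. \<xi> i > 0}"
  define K where "K = insert None (Some ` P)"
  \<comment> \<open>The coefficient of \<open>X\<close> is the sum of the efforts divided by
    \<open>S\<close>, minus one, which leaves minus the prior precision over
    \<open>S\<close>.\<close>
  define a where "a = case_option (- (1 / \<sigma>\<^sup>2) / S) (\<lambda>i. \<xi> i / S)"
  define s where "s = case_option \<sigma> (\<lambda>i. sqrt (1 / \<xi> i))"
  define W where "W = case_option X (\<lambda>i. v i (\<xi> i))"
  have sumP: "(\<Sum>i\<in>P. \<xi> i * h i) = (\<Sum>i\<in>UNIV. \<xi> i * h i)" for h :: "'n \<Rightarrow> real"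
    using \<xi> by (intro sum.mono_neutral_left) (auto simp: P_def not_less order_antisym)
  have sumK: "(\<Sum>k\<in>K. h k) = h None + (\<Sum>i\<in>P. h (Some i))" for h :: "'n option \<Rightarrow> real"
    unfolding K_def by (subst sum.insert) (auto simp: sum.reindex)
  have "distributed M lborel (\<lambda>\<omega>. \<Sum>k\<in>K. a k * W k \<omega>)
      (normal_density (\<Sum>k\<in>K. 0) (sqrt (\<Sum>k\<in>K. (\<bar>a k\<bar> * s k)\<^sup>2)))"
  proof (rule sum_indep_normal)
    show "indep_vars (\<lambda>k. borel) (\<lambda>k \<omega>. a k * W k \<omega>) K"
      using indep_vars_compose2[OF indep_vars_subset[OF ind[folded W_def], of K],
          of "\<lambda>k x. a k * x" "\<lambda>_. borel"] by simp
    fix k assume k: "k \<in> K"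
    then have ak: "a k \<noteq> 0" and sk: "s k > 0"
      using S \<sigma> by (auto simp: a_def s_def K_def P_def)
    then show "0 < \<bar>a k\<bar> * s k" by simp
    have "distributed M lborel (W k) (normal_density 0 (s k))"
      using k X v by (auto simp: W_def s_def K_def P_def)
    from normal_density_affine[OF this sk ak, of 0]
    show "distributed M lborel (\<lambda>\<omega>. a k * W k \<omega>) (normal_density 0 (\<bar>a k\<bar> * s k))" by simp
  qed (auto simp: K_def)
  moreover have "(\<Sum>k\<in>K. a k * W k \<omega>)
      = (\<Sum>i\<in>UNIV. \<xi> i * measurement X (v i) (\<xi> i) \<omega>) / S - X \<omega>" for \<omega>
  proof -
    have "(\<Sum>i\<in>UNIV. \<xi> i * measurement X (v i) (\<xi> i) \<omega>)
        = (\<Sum>i\<in>UNIV. \<xi> i * X \<omega> + \<xi> i * v i (\<xi> i) \<omega>)"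
      by (rule sum.cong) (auto simp: measurement_def algebra_simps)
    also have "\<dots> = (S - 1 / \<sigma>\<^sup>2) * X \<omega> + (\<Sum>i\<in>P. \<xi> i * v i (\<xi> i) \<omega>)"
      unfolding sumP by (simp add: S_def sum.distrib sum_distrib_right)
    finally show ?thesis
      using S by (simp add: sumK a_def W_def sum_divide_distrib[symmetric] diff_divide_distrib
          add_divide_distrib left_diff_distrib)
  qed
  moreover have "(\<Sum>k\<in>K. (\<bar>a k\<bar> * s k)\<^sup>2) = 1 / S"
  proof -
    \<comment> \<open>A squared weight times a variance is a precision over
      \<open>S\<^sup>2\<close>, and the precisions add up to \<open>S\<close>.\<close>
    have "(\<Sum>k\<in>K. (\<bar>a k\<bar> * s k)\<^sup>2) = (1 / \<sigma>\<^sup>2) / S\<^sup>2 + (\<Sum>i\<in>P. \<xi> i * (1 / S\<^sup>2))"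
      unfolding sumK using \<sigma> S
      by (intro arg_cong2[where f="(+)"] sum.cong)
        (auto simp: a_def s_def P_def power_mult_distrib power_divide field_simps power2_eq_square)
    also have "\<dots> = S / S\<^sup>2"
      unfolding sumP by (simp add: S_def sum_distrib_right[symmetric] add_divide_distrib
          sum_divide_distrib)
    finally show ?thesis by (simp add: power2_eq_square)
  qed
  ultimately have "distributed M lborel
      (\<lambda>\<omega>. (\<Sum>i\<in>UNIV. \<xi> i * measurement X (v i) (\<xi> i) \<omega>) / S - X \<omega>)
      (normal_density 0 (sqrt (1 / S)))" by simp
  from distributed_nn_integral[OF this, of "\<lambda>x. ennreal (x\<^sup>2)"]
    nn_integral_normal_square[of "sqrt (1 / S)" 0 0] S
  show ?thesis by simp
qed

end

section \<open>The optimal effort of a truthful sensor\<close>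

text \<open>By the product rule the derivative is
  \<open>(\<xi>x + e) * (2 * c' e + c'' e * (\<xi>x + e))\<close>, and the cost condition says
  exactly that the second factor is positive.\<close>

lemma increasing_effort_index:
  fixes c' c'' :: "real \<Rightarrow> real"
  assumes \<xi>x: "\<xi>x > 0"
    and c': "\<And>e. e \<in> {0..u} \<Longrightarrow> (c' has_real_derivative c'' e) (at e within {0..u})"
    and cond: "\<And>e. e \<in> {0..u} \<Longrightarrow> - 2 * c' e - c'' e * (\<xi>x + e) < 0"
    and ab: "0 \<le> a" "a \<le> b" "b \<le> u"
  shows "c' a * (\<xi>x + a)\<^sup>2 \<le> c' b * (\<xi>x + b)\<^sup>2"
proof (rule DERIV_nonneg_imp_increasing_open[OF ab(2)])
  have D: "((\<lambda>e. c' e * (\<xi>x + e)\<^sup>2) has_real_derivative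
      (\<xi>x + e) * (2 * c' e + c'' e * (\<xi>x + e))) (at e within {0..u})" if "e \<in> {0..u}" for e
    using c'[OF that] by (auto intro!: derivative_eq_intros simp: algebra_simps power2_eq_square)
  show "continuous_on {a..b} (\<lambda>e. c' e * (\<xi>x + e)\<^sup>2)"
  proof (rule continuous_on_subset)
    show "continuous_on {0..u} (\<lambda>e. c' e * (\<xi>x + e)\<^sup>2)"
      unfolding continuous_on_eq_continuous_within using D by (blast intro: DERIV_continuous)
  qed (use ab in auto)
  fix e assume e: "a < e" "e < b"
  \<comment> \<open>The derivatives are one-sided at the ends of the effort range; at interior
    points they become ordinary ones, as the mean value argument demands.\<close>
  then have "at e within {0..u} = at e"
    using ab by (intro at_within_Icc_at) auto
  with D[of e] e ab have "((\<lambda>e. c' e * (\<xi>x + e)\<^sup>2) has_real_derivative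
      (\<xi>x + e) * (2 * c' e + c'' e * (\<xi>x + e))) (at e)" by simp
  moreover have "0 \<le> (\<xi>x + e) * (2 * c' e + c'' e * (\<xi>x + e))"
    using cond[of e] e ab \<xi>x by (intro mult_nonneg_nonneg) auto
  ultimately show "\<exists>y. ((\<lambda>e. c' e * (\<xi>x + e)\<^sup>2) has_real_derivative y) (at e) \<and> 0 \<le> y" by blast
qed

text \<open>The loss falls to the left of \<open>t\<close> and rises to its right, because its
  derivative has the sign of the increasing index minus its value \<open>B\<close> at
  \<open>t\<close>. This makes \<open>t\<close> a global minimizer, also when it is an
  endpoint.\<close>

lemma effort_optimal:
  fixes c c' c'' :: "real \<Rightarrow> real"
  assumes \<xi>x: "\<xi>x > 0"
    and c: "\<And>e. e \<in> {0..u} \<Longrightarrow> (c has_real_derivative c' e) (at e within {0..u})"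
    and c': "\<And>e. e \<in> {0..u} \<Longrightarrow> (c' has_real_derivative c'' e) (at e within {0..u})"
    and cond: "\<And>e. e \<in> {0..u} \<Longrightarrow> - 2 * c' e - c'' e * (\<xi>x + e) < 0"
    and t: "t \<in> {0..u}" and e: "e \<in> {0..u}"
  defines "B \<equiv> c' t * (\<xi>x + t)\<^sup>2"
  shows "c t + B / (\<xi>x + t) \<le> c e + B / (\<xi>x + e)"
proof -
  let ?F = "\<lambda>e. c e + B / (\<xi>x + e)"
  have D: "(?F has_real_derivative (c' x * (\<xi>x + x)\<^sup>2 - B) / (\<xi>x + x)\<^sup>2) (at x within {0..u})"
    if "x \<in> {0..u}" for x
  proof -
    have nz: "\<xi>x + x \<noteq> 0" using that \<xi>x by auto
    then have "(?F has_real_derivative c' x - B / (\<xi>x + x)\<^sup>2) (at x within {0..u})"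
      using c[OF that] by (auto intro!: derivative_eq_intros simp: power2_eq_square)
    also have "c' x - B / (\<xi>x + x)\<^sup>2 = (c' x * (\<xi>x + x)\<^sup>2 - B) / (\<xi>x + x)\<^sup>2"
      using nz by (simp add: field_simps)
    finally show ?thesis .
  qed
  have cont: "continuous_on {0..u} ?F"
    unfolding continuous_on_eq_continuous_within using D by (blast intro: DERIV_continuous)
  have D': "(?F has_real_derivative (c' x * (\<xi>x + x)\<^sup>2 - B) / (\<xi>x + x)\<^sup>2) (at x)"
    if "0 < x" "x < u" for x
    using D[of x] that at_within_Icc_at[of 0 x u] by simp
  show ?thesis
  proof (cases "e \<le> t")
    case True
    show ?thesis
    proof (rule DERIV_nonpos_imp_decreasing_open[OF True])
      fix x assume x: "e < x" "x < t"
      have "c' x * (\<xi>x + x)\<^sup>2 \<le> B"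
        unfolding B_def using x t e by (intro increasing_effort_index[OF \<xi>x c' cond]) auto
      then show "\<exists>y. (?F has_real_derivative y) (at x) \<and> y \<le> 0"
        using D'[of x] x t e by (auto intro!: exI divide_nonpos_nonneg)
    qed (use cont t e in \<open>auto elim: continuous_on_subset\<close>)
  next
    case False
    show ?thesis
    proof (rule DERIV_nonneg_imp_increasing_open[of t e])
      fix x assume x: "t < x" "x < e"
      have "B \<le> c' x * (\<xi>x + x)\<^sup>2"
        unfolding B_def using x t e by (intro increasing_effort_index[OF \<xi>x c' cond]) auto
      then show "\<exists>y. (?F has_real_derivative y) (at x) \<and> 0 \<le> y"
        using D'[of x] x t e by (auto intro!: exI divide_nonneg_nonneg)
    qed (use cont t e False in \<open>auto elim: continuous_on_subset\<close>)
  qed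
qed

section \<open>Equilibrium, accuracy and payments of the mechanism\<close>

lemma fusion_rule_weighted_mean:
  fixes \<xi> :: "'n::finite \<Rightarrow> real"
  shows "(\<lambda>xr yr. (\<Sum>i\<in>UNIV. \<xi> i * yr i) / S) \<in> fusion_rules"
  unfolding fusion_rules_def by simp

lemma measurable_local_estimate[measurable]: "local_estimate \<sigma> e \<in> borel_measurable borel"
  unfolding local_estimate_def[abs_def] by simp

theorem theorem1:
  fixes M :: "'w measure"
    and X :: "'w \<Rightarrow> real"
    and v :: "'n::finite \<Rightarrow> real \<Rightarrow> 'w \<Rightarrow> real"
    and \<sigma>x \<xi>x \<Sigma>t :: real
    and \<xi>u cu :: "'n \<Rightarrow> real"
    and c c' c'' :: "'n \<Rightarrow> real \<Rightarrow> real"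
    and \<xi>t \<beta> \<gamma> :: "'n \<Rightarrow> real"
    and j :: "'n \<Rightarrow> 'n"
    and p :: "'n payment"
  assumes "prob_space M"
    and "\<sigma>x > 0" and "\<xi>x = 1 / \<sigma>x\<^sup>2"
    and "distributed M lborel X (normal_density 0 \<sigma>x)"
    and "\<And>i e. 0 < e \<Longrightarrow> e \<le> \<xi>u i \<Longrightarrow>
           distributed M lborel (v i e) (normal_density 0 (sqrt (1 / e)))"
    and "\<And>e. (\<And>i. e i \<in> {0..\<xi>u i}) \<Longrightarrow>
           prob_space.indep_vars M (\<lambda>_. borel) (case_option X (\<lambda>i. v i (e i))) UNIV"
    and "\<And>i e. e \<in> {0..\<xi>u i} \<Longrightarrow> c i e \<in> {0..cu i}"
    and "\<And>i. c i 0 = 0"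
    and "\<And>i e. e \<in> {0..\<xi>u i} \<Longrightarrow> (c i has_real_derivative c' i e) (at e within {0..\<xi>u i})"
    and "\<And>i e. e \<in> {0..\<xi>u i} \<Longrightarrow> (c' i has_real_derivative c'' i e) (at e within {0..\<xi>u i})"
    and "\<And>i e. e \<in> {0..\<xi>u i} \<Longrightarrow> c' i e > 0"
    and "\<And>i e. e \<in> {0..\<xi>u i} \<Longrightarrow> - 2 * c' i e - c'' i e * (\<xi>x + e) < 0"
    and "\<Sigma>t > 0"
    and "is_arg_min (\<lambda>\<xi>. \<Sum>i\<in>UNIV. c i (\<xi> i))
           (\<lambda>\<xi>. (\<Sum>i\<in>UNIV. \<xi> i) \<ge> inverse \<Sigma>t - \<xi>x \<and> (\<forall>i. \<xi> i \<in> {0..\<xi>u i})) \<xi>t"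
    and "\<And>i. j i \<noteq> i" and "\<And>i. \<xi>t (j i) > 0"
    and "\<And>i. \<beta> i = c' i (\<xi>t i) * (\<xi>x + \<xi>t i)\<^sup>2"
    and "\<And>i. \<gamma> i = \<beta> i * (1 / (\<xi>x + \<xi>t i) + inverse (\<xi>t (j i))) + c i (\<xi>t i)"
    and "\<And>i xr yr. p i xr yr = \<gamma> i - \<beta> i * (xr i - yr (j i))\<^sup>2"
  shows "nash_equilibrium M X v c \<xi>u p (\<lambda>i. truthful \<sigma>x (\<xi>t i))
    \<and> (\<exists>g \<in> fusion_rules. P_feasible M X v c \<xi>u \<Sigma>t p g (\<lambda>i. truthful \<sigma>x (\<xi>t i)))
    \<and> (\<forall>i. expected_payment M X v p (\<lambda>i. truthful \<sigma>x (\<xi>t i)) i = ereal (c i (\<xi>t i)))"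
proof -
  interpret prob_space M by fact
  note \<sigma> = assms(2) and X = assms(4) and noise = assms(5) and indep = assms(6)
  let ?s = "\<lambda>i. truthful \<sigma>x (\<xi>t i)"
  have \<xi>x: "\<xi>x > 0" using assms(2,3) by simp
  have opt: "(\<Sum>i\<in>UNIV. \<xi>t i) \<ge> inverse \<Sigma>t - \<xi>x" and range: "\<xi>t i \<in> {0..\<xi>u i}" for i
    using assms(14) by (auto simp: is_arg_min_def)
  have \<beta>: "\<beta> i > 0" for i
    using assms(11)[OF range, of i] range[of i] \<xi>x by (simp add: assms(17))

  \<comment> \<open>The cost of misreporting: possibly infinite, and zero for a truthful
    report.\<close>
  define err :: "strategy \<Rightarrow> 'n \<Rightarrow> ennreal" where "err t i =
    (\<integral>\<^sup>+\<omega>. ennreal ((est_report t (measurement X (v i) (effort t) \<omega>)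
      - local_estimate \<sigma>x (effort t) (measurement X (v i) (effort t) \<omega>))\<^sup>2) \<partial>M)" for t i
  \<comment> \<open>The constant \<open>k\<close> serves two purposes: \<open>0\<close> gives the
    expected payment, the effort cost gives the expected utility.\<close>
  have expect_dev: "expect M (\<lambda>\<omega>. p i (reported_est X v (?s(i := t)) \<omega>)
        (reported_meas X v (?s(i := t)) \<omega>) - k)
      = ereal (\<gamma> i - k) - ereal (\<beta> i)
        * enn2ereal (ennreal (1 / (\<xi>x + effort t) + inverse (\<xi>t (j i))) + err t i)"
    if t: "t \<in> feasible (\<xi>u i)" for i t k
  proof -
    have e: "effort t \<in> {0..\<xi>u i}" and f[measurable]: "est_report t \<in> borel_measurable borel"
      using t by (auto simp: feasible_def)
    \<comment> \<open>Joint independence is assumed separately for each effort profile, so it is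
      instantiated at the profile after the deviation.\<close>
    define E where "E = \<xi>t(i := effort t)"
    have E: "E k \<in> {0..\<xi>u k}" for k using e range by (simp add: E_def)
    note ind = indep[of E, OF E]
    have Ei: "E i = effort t" and Ej: "E (j i) = \<xi>t (j i)"
      using assms(15) by (simp_all add: E_def)
    have err: "(\<integral>\<^sup>+\<omega>. ennreal ((est_report t (measurement X (v i) (effort t) \<omega>)
          - (X \<omega> + v (j i) (\<xi>t (j i)) \<omega>))\<^sup>2) \<partial>M)
        = ennreal (1 / (\<xi>x + effort t) + inverse (\<xi>t (j i))) + err t i"
      unfolding err_def assms(3)
      using report_error[OF ind X \<sigma>, of "effort t" "v i" "est_report t" i "j i" "\<xi>t (j i)"]
        e f assms(15,16) range[of "j i"] noise[of "effort t" i] noise[of "\<xi>t (j i)" "j i"]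
      by (simp add: Ei Ej)
    have rv: "random_variable borel (case_option X (\<lambda>k. v k (E k)) k)" for k
      using ind by (auto simp: indep_vars_def)
    have U[measurable]: "random_variable borel (v i (effort t))"
      and [measurable]: "random_variable borel X" "random_variable borel (v (j i) (\<xi>t (j i)))"
      using rv[of "Some i"] rv[of None] rv[of "Some (j i)"] by (simp_all add: Ei Ej)
    have [measurable]: "measurement X (v i) (effort t) \<in> borel_measurable M"
      using U by (cases "effort t = 0") (simp_all add: measurement_def[abs_def])
    \<comment> \<open>As \<open>j i\<close> differs from \<open>i\<close>, the deviation leaves the
      peer truthful; as the peer's effort is positive, its report is \<open>X\<close> plus
      noise.\<close>
    have "(\<lambda>\<omega>. p i (reported_est X v (?s(i := t)) \<omega>) (reported_meas X v (?s(i := t)) \<omega>) - k)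
      = (\<lambda>\<omega>. (\<gamma> i - k) - \<beta> i * (est_report t (measurement X (v i) (effort t) \<omega>)
          - (X \<omega> + v (j i) (\<xi>t (j i)) \<omega>))\<^sup>2)"
      using assms(15)[of i] assms(16)[of i]
      by (simp add: assms(19) reported_est_def reported_meas_def truthful_def measurement_def
          fun_eq_iff)
    then show ?thesis
      by (simp add: expect_affine \<beta> err)
  qed

  have feas: "?s i \<in> feasible (\<xi>u i)" for i
    using range[of i] by (simp add: feasible_def truthful_def)
  have err0: "err (?s i) i = 0" for i
    by (simp add: err_def truthful_def)
  \<comment> \<open>Truth-telling is viewed as the trivial deviation; \<open>\<gamma> i\<close> is
    calibrated to refund the unavoidable expected penalty and add the effort cost.\<close>
  have at_truth: "expect M (\<lambda>\<omega>. p i (reported_est X v ?s \<omega>) (reported_meas X v ?s \<omega>) - k)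
      = ereal (c i (\<xi>t i) - k)" for i k
  proof -
    have "\<xi>x + \<xi>t i > 0" "inverse (\<xi>t (j i)) > 0"
      using \<xi>x range[of i] assms(16) by (auto intro: add_pos_nonneg)
    then have "0 \<le> 1 / (\<xi>x + \<xi>t i) + inverse (\<xi>t (j i))" by simp
    moreover have "?s(i := ?s i) = ?s" "effort (?s i) = \<xi>t i"
      by (simp_all add: fun_eq_iff truthful_def)
    ultimately show ?thesis
      using expect_dev[OF feas, of i k] by (simp add: err0 enn2ereal_ennreal assms(18))
  qed

  have nash: "nash_equilibrium M X v c \<xi>u p ?s"
    unfolding nash_equilibrium_def
  proof (intro conjI allI ballI feas)
    fix i t assume t: "t \<in> feasible (\<xi>u i)"
    then have e: "effort t \<in> {0..\<xi>u i}" by (simp add: feasible_def)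
    let ?m = "1 / (\<xi>x + effort t) + inverse (\<xi>t (j i))"
    have m: "0 \<le> ?m" using e \<xi>x assms(16)[of i] by simp
    have "expected_utility M X v c p (?s(i := t)) i
        = ereal (\<gamma> i - c i (effort t)) - ereal (\<beta> i) * enn2ereal (ennreal ?m + err t i)"
      unfolding expected_utility_def using expect_dev[OF t] by simp
    \<comment> \<open>Dropping the misreporting error reduces the deviation to a change of effort
      alone, which \<open>effort_optimal\<close> then bounds. The peer's noise term cancels against
      \<open>\<gamma> i\<close>.\<close>
    also have "\<dots> \<le> ereal (\<gamma> i - c i (effort t)) - ereal (\<beta> i) * enn2ereal (ennreal ?m)"
      using \<beta>[of i] by (intro ereal_minus_mono ereal_mult_left_mono)
        (simp_all add: less_eq_ennreal.rep_eq[symmetric])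
    also have "\<dots> = ereal (\<gamma> i - c i (effort t) - \<beta> i * ?m)"
      using m by (simp add: enn2ereal_ennreal)
    also have "\<dots> \<le> ereal (c i (\<xi>t i) - c i (\<xi>t i))"
      using effort_optimal[OF \<xi>x assms(9,10,12) range e]
      by (simp add: assms(17,18) algebra_simps)
    also have "\<dots> = expected_utility M X v c p ?s i"
      unfolding expected_utility_def at_truth[symmetric] by (simp add: truthful_def)
    finally show "expected_utility M X v c p (?s(i := t)) i \<le> expected_utility M X v c p ?s i" .
  qed

  let ?S = "1 / \<sigma>x\<^sup>2 + (\<Sum>i\<in>UNIV. \<xi>t i)"
  \<comment> \<open>The posterior mean of \<open>X\<close> given all measurements: including the
    prior precision in \<open>?S\<close> shrinks the weighted mean towards the prior mean
    \<open>0\<close>.\<close>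
  let ?g = "\<lambda>(xr :: 'n \<Rightarrow> real) yr. (\<Sum>i\<in>UNIV. \<xi>t i * yr i) / ?S"
  have "global_mse M X v ?g ?s = enn2ereal (ennreal (1 / ?S))"
    unfolding global_mse_def expect_def
    using fusion_error[where v = v and \<xi> = \<xi>t, OF indep[of \<xi>t, OF range] X \<sigma>] noise range
    by (simp add: reported_meas_def truthful_def ennreal_neg zero_ennreal.rep_eq)
  also have "\<dots> \<le> ereal \<Sigma>t"
  proof -
    have S: "inverse \<Sigma>t \<le> ?S" using opt assms(3) by simp
    have "1 / ?S \<le> \<Sigma>t"
      using le_imp_inverse_le[OF S] assms(13) by (simp add: inverse_eq_divide)
    moreover have "0 \<le> 1 / ?S"
      using order_trans[OF _ S, of 0] assms(13) by simp
    ultimately show ?thesis by (simp add: enn2ereal_ennreal)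
  qed
  finally have "P_feasible M X v c \<xi>u \<Sigma>t p ?g ?s"
    \<comment> \<open>With \<open>k\<close> equal to the effort cost, \<open>at_truth\<close> gives
      utility exactly zero, so individual rationality binds.\<close>
    using nash at_truth
    by (auto simp: P_feasible_def expected_utility_def truthful_def)
  then show ?thesis
    using nash fusion_rule_weighted_mean at_truth[of _ 0]
    by (auto simp: expected_payment_def)
qed

end
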